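(* Let $d\in\mathbb{N}$, $\bm n\in\mathbb{N}_0^d$, $T>0$, let $\Phi\in\operatorname{span}\Pi_{\bm n}$ and let $\bm A_0\in\mathbb{R}^{\bm n+1}$ be the coefficient tensor with $v_{\bm A_0}=\Phi$. Let $\bm L$, $\bm{NL}$ and $\bm P=\bm P_{2\bm n,\bm n}$ be the operators defined in the context. (i) If $\bm A(t)\in\mathbb{R}^{\bm n+1}$, $t\in[0,T]$, is a solution of the tensor-valued ODE $$\dot{\bm A}(t)=\bm L\bm A(t)+\bm P\,\bm{NL}(\bm A(t)),\qquad \bm A(0)=\bm A_0,\qquad t\in[0,T],\qquad (\ast)$$ then $v_t:=v_{\bm A(t)}$ solves the projected Hamilton–Jacobi–Bellman equation $$\partial_t v_t=\mathcal P_{2\bm n,\bm n}\big[\operatorname{Lin}(v_t)+\operatorname{NonLin}(v_t)\big],\qquad v_0=\Phi,\qquad \text{in }K,\ t\in[0,T].\qquad (\ast\ast)$$ (ii) Conversely, if $v_t\in\operatorname{span}\Pi_{\bm n}$, $t\in[0,T]$, solves $(\ast\ast)$, then for every $t$ there exists a unique $\bm A(t)\in\mathbb{R}^{\bm n+1}$ such that $v_t=v_{\bm A(t)}$, and $\bm A(t)$ solves $(\ast)$.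
   Context: Notation. $K=\prod_{i=1}^d[a_i,b_i]\subset\mathbb{R}^d$ with $a_i<b_i$. For $\bm n=(n_1,\dots,n_d)\in\mathbb{N}_0^d$: $[\bm n]=\prod_{i=1}^d\{0,\dots,n_i\}$, $2\bm n=(2n_1,\dots,2n_d)$, and $\mathbb{R}^{\bm n+1}=\mathbb{R}^{n_1+1,\dots,n_d+1}$ is the space of real tensors indexed by $\bm\alpha\in[\bm n]$ (indices start at $0$). Polynomials. For $i=1,\dots,d$ and $\alpha\in\mathbb{N}_0$, $p^i_\alpha$ is the $\alpha$-th (degree $\alpha$) Legendre polynomial on $[a_i,b_i]$, orthonormal in $L^2([a_i,b_i])$. Set $p_{\bm\alpha}(x)=\prod_{i=1}^d p^i_{\alpha_i}(x_i)$ and $\Pi_{\bm n}=\{p_{\bm\alpha}:\bm\alpha\in[\bm n]\}$. For $\bm A\in\mathbb{R}^{\bm n+1}$, $v_{\bm A}:=\sum_{\bm\alpha\in[\bm n]}\bm A[\bm\alpha]\,p_{\bm\alpha}\in\operatorname{span}\Pi_{\bm n}$. Operators on functions. $\operatorname{Lin}(v)=\Delta v+x\cdot\nabla v$ and $\operatorname{NonLin}(v)=-\|\nabla v\|^2$ (Euclidean norm). For $\bm n\le\bm m$ (componentwise), $\mathcal P_{\bm m,\bm n}:\operatorname{span}\Pi_{\bm m}\to\operatorname{span}\Pi_{\bm n}$, $\mathcal P_{\bm m,\bm n}(v)=\sum_{\bm\alpha\in[\bm n]}p_{\bm\alpha}\langle p_{\bm\alpha},v\rangle_{L^2(K)}$.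 The time derivative $\partial_t v_t$ is taken pointwise in $x\in K$. Operators on tensors. $T_{i,n}\in\mathbb{R}^{n+1,n+1}$ is the invertible matrix mapping the coefficients of a polynomial of degree at most $n$ with respect to $p^i_0,\dots,p^i_n$ to its coefficients with respect to the monomials $1,x,\dots,x^n$. Let $M_d^i,M_{dd}^i,M_{xd}^i\in\mathbb{R}^{n_i+1,n_i+1}$ be the matrices of $\partial_x$, $\partial_x^2$ and $x\partial_x$ with respect to the monomial basis $1,x,\dots,x^{n_i}$ (i.e. $M_d^i[\alpha-1,\alpha]=\alpha$, $M_{dd}^i[\alpha-2,\alpha]=\alpha(\alpha-1)$, $M_{xd}^i[\alpha,\alpha]=\alpha$, all other entries $0$). Set $D_i=T_{i,n_i}^{-1}(M_{dd}^i+M_{xd}^i)T_{i,n_i}$ and $D_{x_i}=T_{i,n_i}^{-1}M_d^iT_{i,n_i}$. With $I_k$ the $k\times k$ identity matrix, $$\bm L=\sum_{i=1}^d I_{n_1+1}\otimes\cdots\otimes I_{n_{i-1}+1}\otimes D_i\otimes I_{n_{i+1}+1}\otimes\cdots\otimes I_{n_d+1},$$ and $\bm L_{x_i}$ is the operator with $D_{x_i}$ in position $i$ and identities elsewhere; a tensor product of matrices acts on $\mathbb{R}^{\bm n+1}$ by applying the $j$-th matrix to the $j$-th index. For $\bm A,\bm B\in\mathbb{R}^{\bm n+1}$ let $\hat{\bm A}=(T_{1,n_1}\otimes\cdots\otimes T_{d,n_d})\bm A$ and $\hat{\bm B}=(T_{1,n_1}\otimes\cdots\otimes T_{d,n_d})\bm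 B$ (monomial coefficients), let $\hat{\bm C}\in\mathbb{R}^{2\bm n+1}$ be $\hat{\bm C}[\bm\gamma]=\sum_{\bm\alpha,\bm\beta\in[\bm n],\,\bm\alpha+\bm\beta=\bm\gamma}\hat{\bm A}[\bm\alpha]\hat{\bm B}[\bm\beta]$, and define $\bm M_{\bm B}(\bm A)=(T_{1,2n_1}^{-1}\otimes\cdots\otimes T_{d,2n_d}^{-1})\hat{\bm C}\in\mathbb{R}^{2\bm n+1}$. Set $\bm S(\bm A)=\bm M_{\bm A}(\bm A)$ and $$\bm{NL}(\bm A)=-\sum_{i=1}^d\bm S(\bm L_{x_i}\bm A)\in\mathbb{R}^{2\bm n+1}.$$ Finally $\bm P_{\bm m,\bm n}:\mathbb{R}^{\bm m+1}\to\mathbb{R}^{\bm n+1}$ is truncation, $(\bm P_{\bm m,\bm n}\bm A)[\bm\alpha]=\bm A[\bm\alpha]$ for $\bm\alpha\in[\bm n]$. *)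

theory Defs
  imports
    "HOL-Analysis.Analysis"
    "HOL-Computational_Algebra.Polynomial"
    "HOL-Library.Function_Algebras"
    "Jordan_Normal_Form.Gauss_Jordan_Elimination"
begin

no_notation Matrix.vec_index (infixl "$" 100)

(* The dimension d is CARD('d); the box K is cbox a b for a, b :: real^'d.
   Multi-indices are functions 'd \<Rightarrow> nat. A tensor in R^(n+1) is a real function on
   multi-indices that vanishes outside [n], so that equality of tensors is equality of functions.
   In particular truncation need not mention the shape of its argument. *)

definition midx :: "('d::finite \<Rightarrow> nat) \<Rightarrow> ('d \<Rightarrow> nat) set" where
  "midx n = {\<alpha>. \<forall>i. \<alpha> i \<le> n i}"

definition dbl :: "('d::finite \<Rightarrow> nat) \<Rightarrow> 'd \<Rightarrow> nat" where
  "dbl n = (\<lambda>i. 2 * n i)"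

type_synonym 'd tensor = "('d \<Rightarrow> nat) \<Rightarrow> real"

definition tensors :: "('d::finite \<Rightarrow> nat) \<Rightarrow> 'd tensor set" where
  "tensors n = {A. \<forall>\<alpha>. \<alpha> \<notin> midx n \<longrightarrow> A \<alpha> = 0}"

definition trunc :: "('d::finite \<Rightarrow> nat) \<Rightarrow> 'd tensor \<Rightarrow> 'd tensor" where
  "trunc n A = (\<lambda>\<alpha>. if \<alpha> \<in> midx n then A \<alpha> else 0)"


subsection \<open>Polynomials\<close>

(* Rodrigues' formula for the Legendre polynomials on [-1,1], normalised by P_k(1) = 1. *)
definition legendre_std :: "nat \<Rightarrow> real poly" where
  "legendre_std k = Polynomial.smult (1 / (2 ^ k * fact k)) ((pderiv ^^ k) ([:-1, 0, 1:] ^ k))"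

(* Pulled back to [lo,hi] along x \<mapsto> (2x - lo - hi)/(hi - lo). Since the squared L2 norm of
   P_k on [-1,1] is 2/(2k+1), the factor makes the family orthonormal in L2([lo,hi]);
   the sign is the usual one (positive leading coefficient). *)
definition legendre_on :: "real \<Rightarrow> real \<Rightarrow> nat \<Rightarrow> real poly" where
  "legendre_on lo hi k =
     Polynomial.smult (sqrt ((2 * real k + 1) / (hi - lo)))
       (pcompose (legendre_std k) [:- (lo + hi) / (hi - lo), 2 / (hi - lo):])"

definition leg_prod :: "real^'d::finite \<Rightarrow> real^'d \<Rightarrow> ('d \<Rightarrow> nat) \<Rightarrow> real^'d \<Rightarrow> real" where
  "leg_prod a b \<alpha> = (\<lambda>x. \<Prod>i\<in>UNIV. poly (legendre_on (a $ i) (b $ i) (\<alpha> i)) (x $ i))"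

interpretation real_fun: vector_space "\<lambda>(c::real) (f :: 'a \<Rightarrow> real) x. c * f x"
  by unfold_locales (auto simp: fun_eq_iff algebra_simps)

(* Members of the span are polynomial functions on all of R^d, so that their partial derivatives
   are two-sided ones also at boundary points of K. As K has nonempty interior, they are
   determined by their values on K. *)
definition span_leg :: "real^'d::finite \<Rightarrow> real^'d \<Rightarrow> ('d \<Rightarrow> nat) \<Rightarrow> (real^'d \<Rightarrow> real) set" where
  "span_leg a b n = real_fun.span (leg_prod a b ` midx n)"

definition v_of ::
  "real^'d::finite \<Rightarrow> real^'d \<Rightarrow> ('d \<Rightarrow> nat) \<Rightarrow> 'd tensor \<Rightarrow> real^'d \<Rightarrow> real" where
  "v_of a b n A = (\<lambda>x. \<Sum>\<alpha>\<in>midx n. A \<alpha> * leg_prod a b \<alpha> x)"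


subsection \<open>Operators on functions\<close>

definition pd :: "'d::finite \<Rightarrow> (real^'d \<Rightarrow> real) \<Rightarrow> real^'d \<Rightarrow> real" where
  "pd i v x = deriv (\<lambda>s. v (x + s *\<^sub>R axis i 1)) 0"

definition grad :: "(real^'d::finite \<Rightarrow> real) \<Rightarrow> real^'d \<Rightarrow> real^'d" where
  "grad v x = (\<chi> i. pd i v x)"

definition laplacian :: "(real^'d::finite \<Rightarrow> real) \<Rightarrow> real^'d \<Rightarrow> real" where
  "laplacian v x = (\<Sum>i\<in>UNIV. pd i (pd i v) x)"

definition Lin :: "(real^'d::finite \<Rightarrow> real) \<Rightarrow> real^'d \<Rightarrow> real" where
  "Lin v = (\<lambda>x. laplacian v x + inner x (grad v x))"

definition NonLin :: "(real^'d::finite \<Rightarrow> real) \<Rightarrow> real^'d \<Rightarrow> real" where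
  "NonLin v = (\<lambda>x. - (norm (grad v x))\<^sup>2)"

definition L2_inner ::
  "real^'d::finite \<Rightarrow> real^'d \<Rightarrow> (real^'d \<Rightarrow> real) \<Rightarrow> (real^'d \<Rightarrow> real) \<Rightarrow> real" where
  "L2_inner a b f g = (LINT x:cbox a b|lborel. f x * g x)"

(* The domain span_leg a b m does not enter the formula. *)
definition proj ::
  "real^'d::finite \<Rightarrow> real^'d \<Rightarrow> ('d \<Rightarrow> nat) \<Rightarrow> (real^'d \<Rightarrow> real) \<Rightarrow> real^'d \<Rightarrow> real" where
  "proj a b n v = (\<lambda>x. \<Sum>\<alpha>\<in>midx n. leg_prod a b \<alpha> x * L2_inner a b (leg_prod a b \<alpha>) v)"


subsection \<open>Operators on tensors\<close>

(* Column \<alpha> holds the monomial coefficients of the \<alpha>-th Legendre polynomial. *)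
definition Tmat :: "real \<Rightarrow> real \<Rightarrow> nat \<Rightarrow> real mat" where
  "Tmat lo hi k = mat (k + 1) (k + 1) (\<lambda>(r, \<alpha>). Polynomial.coeff (legendre_on lo hi \<alpha>) r)"

definition Tinv :: "real \<Rightarrow> real \<Rightarrow> nat \<Rightarrow> real mat" where
  "Tinv lo hi k = the (mat_inverse (Tmat lo hi k))"

definition Md :: "nat \<Rightarrow> real mat" where
  "Md k = mat (k + 1) (k + 1) (\<lambda>(r, \<alpha>). if r + 1 = \<alpha> then real \<alpha> else 0)"

definition Mdd :: "nat \<Rightarrow> real mat" where
  "Mdd k = mat (k + 1) (k + 1) (\<lambda>(r, \<alpha>). if r + 2 = \<alpha> then real \<alpha> * (real \<alpha> - 1) else 0)"

definition Mxd :: "nat \<Rightarrow> real mat" where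
  "Mxd k = mat (k + 1) (k + 1) (\<lambda>(r, \<alpha>). if r = \<alpha> then real \<alpha> else 0)"

definition Dlin :: "real \<Rightarrow> real \<Rightarrow> nat \<Rightarrow> real mat" where
  "Dlin lo hi k = Tinv lo hi k * (Mdd k + Mxd k) * Tmat lo hi k"

definition Dx :: "real \<Rightarrow> real \<Rightarrow> nat \<Rightarrow> real mat" where
  "Dx lo hi k = Tinv lo hi k * Md k * Tmat lo hi k"

(* The tensor product of the matrices M j, acting on the j-th index by M j. *)
definition tensor_op :: "('d::finite \<Rightarrow> real mat) \<Rightarrow> 'd tensor \<Rightarrow> 'd tensor" where
  "tensor_op M A = (\<lambda>\<alpha>. if \<forall>j. \<alpha> j < dim_row (M j)
     then \<Sum>\<beta> | \<forall>j. \<beta> j < dim_col (M j). (\<Prod>j\<in>UNIV. M j $$ (\<alpha> j, \<beta> j)) * A \<beta>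
     else 0)"

definition at_pos :: "('d::finite \<Rightarrow> nat) \<Rightarrow> 'd \<Rightarrow> real mat \<Rightarrow> 'd \<Rightarrow> real mat" where
  "at_pos n i D = (\<lambda>j. if j = i then D else 1\<^sub>m (n j + 1))"

definition Lop ::
  "real^'d::finite \<Rightarrow> real^'d \<Rightarrow> ('d \<Rightarrow> nat) \<Rightarrow> 'd tensor \<Rightarrow> 'd tensor" where
  "Lop a b n A = (\<lambda>\<alpha>. \<Sum>i\<in>UNIV. tensor_op (at_pos n i (Dlin (a $ i) (b $ i) (n i))) A \<alpha>)"

definition Lx ::
  "real^'d::finite \<Rightarrow> real^'d \<Rightarrow> ('d \<Rightarrow> nat) \<Rightarrow> 'd \<Rightarrow> 'd tensor \<Rightarrow> 'd tensor" where
  "Lx a b n i A = tensor_op (at_pos n i (Dx (a $ i) (b $ i) (n i))) A"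

definition to_mono ::
  "real^'d::finite \<Rightarrow> real^'d \<Rightarrow> ('d \<Rightarrow> nat) \<Rightarrow> 'd tensor \<Rightarrow> 'd tensor" where
  "to_mono a b n A = tensor_op (\<lambda>j. Tmat (a $ j) (b $ j) (n j)) A"

definition from_mono ::
  "real^'d::finite \<Rightarrow> real^'d \<Rightarrow> ('d \<Rightarrow> nat) \<Rightarrow> 'd tensor \<Rightarrow> 'd tensor" where
  "from_mono a b n A = tensor_op (\<lambda>j. Tinv (a $ j) (b $ j) (n j)) A"

definition tconv :: "('d::finite \<Rightarrow> nat) \<Rightarrow> 'd tensor \<Rightarrow> 'd tensor \<Rightarrow> 'd tensor" where
  "tconv n A B = (\<lambda>\<gamma>. \<Sum>(\<alpha>, \<beta>) | \<alpha> \<in> midx n \<and> \<beta> \<in> midx n \<and> (\<forall>i. \<alpha> i + \<beta> i = \<gamma> i).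
     A \<alpha> * B \<beta>)"

definition Mult ::
  "real^'d::finite \<Rightarrow> real^'d \<Rightarrow> ('d \<Rightarrow> nat) \<Rightarrow> 'd tensor \<Rightarrow> 'd tensor \<Rightarrow> 'd tensor" where
  "Mult a b n B A = from_mono a b (dbl n) (tconv n (to_mono a b n A) (to_mono a b n B))"

definition Sq ::
  "real^'d::finite \<Rightarrow> real^'d \<Rightarrow> ('d \<Rightarrow> nat) \<Rightarrow> 'd tensor \<Rightarrow> 'd tensor" where
  "Sq a b n A = Mult a b n A A"

definition NL ::
  "real^'d::finite \<Rightarrow> real^'d \<Rightarrow> ('d \<Rightarrow> nat) \<Rightarrow> 'd tensor \<Rightarrow> 'd tensor" where
  "NL a b n A = (\<lambda>\<alpha>. - (\<Sum>i\<in>UNIV. Sq a b n (Lx a b n i A) \<alpha>))"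


subsection \<open>The two evolution equations\<close>

(* The time derivative of a tensor is taken entrywise; at 0 and T all time derivatives
   are one-sided. *)
definition solves_ode ::
  "real^'d::finite \<Rightarrow> real^'d \<Rightarrow> ('d \<Rightarrow> nat) \<Rightarrow> real \<Rightarrow> 'd tensor \<Rightarrow> (real \<Rightarrow> 'd tensor) \<Rightarrow> bool"
  where
  "solves_ode a b n T A0 A \<longleftrightarrow>
     (\<forall>t\<in>{0..T}. A t \<in> tensors n) \<and> A 0 = A0 \<and>
     (\<forall>t\<in>{0..T}. \<forall>\<alpha>\<in>midx n.
        ((\<lambda>s. A s \<alpha>) has_real_derivative
           Lop a b n (A t) \<alpha> + trunc n (NL a b n (A t)) \<alpha>) (at t within {0..T}))"

definition solves_hjb ::
  "real^'d::finite \<Rightarrow> real^'d \<Rightarrow> ('d \<Rightarrow> nat) \<Rightarrow> real \<Rightarrow> (real^'d \<Rightarrow> real)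
     \<Rightarrow> (real \<Rightarrow> real^'d \<Rightarrow> real) \<Rightarrow> bool"
  where
  "solves_hjb a b n T \<Phi> v \<longleftrightarrow>
     (\<forall>t\<in>{0..T}. v t \<in> span_leg a b n) \<and> (\<forall>x\<in>cbox a b. v 0 x = \<Phi> x) \<and>
     (\<forall>t\<in>{0..T}. \<forall>x\<in>cbox a b.
        ((\<lambda>s. v s x) has_real_derivative
           proj a b n (\<lambda>y. Lin (v t) y + NonLin (v t) y) x) (at t within {0..T}))"

end

(*
  Column beta of a matrix M in the construction turns a family q of univariate polynomials into
  the combination sum_r M[r,beta] q_r. Under this action T sends the monomials to the Legendre
  polynomials, hence D_i and D_{x_i} send p_k to p_k'' + x p_k' and p_k', and multilinearity of
  A |-> v_A carries this over to tensor products: v_{L A} = Lin(v_A), v_{L_{x_i} A} = d_i v_A, and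
  v_{S(A)} = (v_A)^2 because multiplying polynomials convolves monomial coefficients. The Legendre
  products are orthonormal, so projecting v_B is truncating B, and both right-hand sides agree.
  For the converse the pointwise time derivative has to be transferred to the coefficients:
  every coefficient of v_B is a fixed linear combination of finitely many point values of v_B in K.
*)

theory Submission
  imports Defs "Jordan_Normal_Form.Determinant"
begin

subsection \<open>Integrals of univariate polynomials\<close>

text \<open>Taking a polynomial as argument lets additivity, integration by parts and substitution
  follow from antiderivatives, so that integration becomes algebra on \<open>real poly\<close>
  without recurring integrability conditions.\<close>

definition poly_integral :: "real \<Rightarrow> real \<Rightarrow> real poly \<Rightarrow> real" where
  "poly_integral lo hi p = (LINT x:{lo..hi}|lborel. poly p x)"

lemma poly_integral_pderiv:
  assumes "lo \<le> hi"
  shows "poly_integral lo hi (pderiv p) = poly p hi - poly p lo"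
  unfolding poly_integral_def set_lebesgue_integral_def
  by (rule integral_FTC_atLeastAtMost[OF assms])
     (auto intro!: continuous_intros intro: has_field_derivative_at_within
           simp: has_real_derivative_iff_has_vector_derivative[symmetric])

text \<open>Through \<open>poly_integral_pderiv\<close>, every integral of a polynomial thereby
  reduces to boundary values of an antiderivative.\<close>

lemma pderiv_surj: "\<exists>P. pderiv P = (p :: real poly)"
proof -
  let ?P = "\<Sum>i\<le>Polynomial.degree p. Polynomial.monom (Polynomial.coeff p i / real (Suc i)) (Suc i)"
  have "pderiv ?P = (\<Sum>i\<le>Polynomial.degree p. Polynomial.monom (Polynomial.coeff p i) i)"
    by (simp add: higher_pderiv_sum[of 1, simplified] pderiv_monom del: of_nat_Suc)
  also have "\<dots> = p"
    by (rule poly_as_sum_of_monoms)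
  finally show ?thesis ..
qed

lemma poly_integral_add:
  assumes "lo \<le> hi"
  shows "poly_integral lo hi (p + q) = poly_integral lo hi p + poly_integral lo hi q"
proof -
  obtain P Q where "p = pderiv P" "q = pderiv Q"
    by (metis pderiv_surj)
  then show ?thesis
    using poly_integral_pderiv[OF assms, of "P + Q"]
    by (simp add: pderiv_add poly_integral_pderiv[OF assms])
qed

lemma poly_integral_smult:
  "poly_integral lo hi (Polynomial.smult c p) = c * poly_integral lo hi p"
  by (simp add: poly_integral_def)

lemma poly_integral_0 [simp]: "poly_integral lo hi 0 = 0"
  by (simp add: poly_integral_def)

lemma poly_integral_by_parts:
  assumes "lo \<le> hi" "poly q lo = 0" "poly q hi = 0"
  shows "poly_integral lo hi (p * pderiv q) = - poly_integral lo hi (pderiv p * q)"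
  using poly_integral_pderiv[OF assms(1), of "p * q"] assms
  by (simp add: pderiv_mult poly_integral_add mult.commute)

text \<open>Every boundary term contains a derivative of \<open>u\<close> of order below
  \<open>k\<close> and hence vanishes. Each integration by parts differentiates the other factor, so
  the induction keeps \<open>q\<close> arbitrary.\<close>

lemma poly_integral_by_parts_iterated:
  assumes "lo \<le> hi"
    and "\<And>i. i < k \<Longrightarrow> poly ((pderiv ^^ i) u) lo = 0 \<and> poly ((pderiv ^^ i) u) hi = 0"
  shows "poly_integral lo hi (q * (pderiv ^^ k) u)
       = (- 1) ^ k * poly_integral lo hi ((pderiv ^^ k) q * u)"
  using assms(2)
proof (induction k arbitrary: q)
  case 0
  then show ?case by simp
next
  case (Suc k)
  have "poly_integral lo hi (q * (pderiv ^^ Suc k) u)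
      = - poly_integral lo hi (pderiv q * (pderiv ^^ k) u)"
    using Suc.prems by (simp add: poly_integral_by_parts[OF assms(1)])
  also have "\<dots> = - ((- 1) ^ k * poly_integral lo hi ((pderiv ^^ k) (pderiv q) * u))"
    using Suc.IH[of "pderiv q"] Suc.prems by simp
  finally show ?case
    by (simp add: funpow_swap1)
qed

text \<open>The affine map sends \<open>lo\<close> to -1 and \<open>hi\<close> to 1; composing an
  antiderivative of \<open>p\<close> with it and scaling by \<open>(hi - lo) / 2\<close> gives an
  antiderivative of the composed polynomial.\<close>

lemma poly_integral_pcompose:
  assumes "lo < hi"
  shows "poly_integral lo hi (pcompose p [:- (lo + hi) / (hi - lo), 2 / (hi - lo):])
       = (hi - lo) / 2 * poly_integral (- 1) 1 p"
proof -
  let ?l = "[:- (lo + hi) / (hi - lo), 2 / (hi - lo):]"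
  obtain P where P: "p = pderiv P"
    by (metis pderiv_surj)
  have ends: "poly ?l hi = 1" "poly ?l lo = - 1"
    using assms by (simp_all add: divide_simps)
  have "pcompose p ?l = pderiv (Polynomial.smult ((hi - lo) / 2) (pcompose P ?l))"
  proof -
    have "pderiv ?l = [:2 / (hi - lo):]"
      by (simp add: pderiv_pCons)
    moreover have "(hi - lo) / 2 * (2 / (hi - lo)) = 1"
      using assms by simp
    ultimately show ?thesis
      by (simp only: P pderiv_smult pderiv_pcompose mult_smult_right[symmetric] smult_pCons) simp
  qed
  then have "poly_integral lo hi (pcompose p ?l) = (hi - lo) / 2 * (poly P 1 - poly P (- 1))"
    using assms by (simp only: poly_integral_pderiv less_imp_le poly_smult poly_pcompose ends right_diff_distrib)
  then show ?thesis
    by (simp add: P poly_integral_pderiv)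
qed


subsection \<open>Legendre polynomials\<close>

text \<open>By the product rule a derivative costs at most one factor \<open>c\<close>. For
  \<open>k = 0\<close> truncated subtraction turns the divisor into 1.\<close>

lemma dvd_power_pderiv:
  fixes c p :: "real poly"
  assumes "c ^ k dvd p"
  shows "c ^ (k - 1) dvd pderiv p"
proof (cases k)
  case (Suc m)
  with assms obtain r where "p = c ^ Suc m * r" by blast
  then have "pderiv p = c ^ m * (c * pderiv r + Polynomial.smult (of_nat (Suc m)) (pderiv c) * r)"
    by (simp add: pderiv_mult pderiv_power_Suc algebra_simps del: of_nat_Suc power_Suc) (simp add: algebra_simps)
  then show ?thesis
    by (simp add: Suc)
qed simp

lemma dvd_power_higher_pderiv:
  fixes c p :: "real poly"
  assumes "c ^ k dvd p"
  shows "c ^ (k - i) dvd (pderiv ^^ i) p"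
proof (induction i)
  case (Suc i)
  from dvd_power_pderiv[OF Suc] show ?case by simp
qed (use assms in simp)

abbreviation x2m1 :: "real poly" where "x2m1 \<equiv> [:- 1, 0, 1:]"

text \<open>Fewer than \<open>k\<close> derivatives leave at least one factor \<open>x2m1\<close>,
  which is zero at -1 and 1. These are the boundary conditions for integrating Rodrigues' formula by
  parts.\<close>

lemma higher_pderiv_x2m1_power_ends:
  assumes "i < k"
  shows "poly ((pderiv ^^ i) (x2m1 ^ k)) (- 1) = 0 \<and> poly ((pderiv ^^ i) (x2m1 ^ k)) 1 = 0"
proof -
  have "x2m1 dvd x2m1 ^ (k - i)"
    using assms by (simp add: dvd_power)
  also have "\<dots> dvd (pderiv ^^ i) (x2m1 ^ k)"
    by (rule dvd_power_higher_pderiv) simp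
  finally show ?thesis
    by (auto simp: dvd_def)
qed

lemma degree_x2m1_power: "Polynomial.degree (x2m1 ^ k) = 2 * k"
  by (simp add: degree_power_eq)

lemma coeff_x2m1_power: "Polynomial.coeff (x2m1 ^ k) (2 * k) = 1"
  using lead_coeff_power[of x2m1 k] by (simp add: degree_x2m1_power)

lemma degree_legendre_std: "Polynomial.degree (legendre_std k) = k"
  by (simp add: legendre_std_def degree_higher_pderiv degree_x2m1_power)

lemma higher_pderiv_degree:
  fixes p :: "real poly"
  assumes "Polynomial.degree p \<le> k"
  shows "(pderiv ^^ k) p = [:fact k * Polynomial.coeff p k:]"
proof (rule poly_eqI)
  fix i
  show "Polynomial.coeff ((pderiv ^^ k) p) i = Polynomial.coeff [:fact k * Polynomial.coeff p k:] i"
    using assms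
    by (cases i) (auto simp: coeff_higher_pderiv coeff_pCons pochhammer_fact coeff_eq_0)
qed

text \<open>Only the leading term x^(2k) of \<open>x2m1 ^ k\<close> reaches degree k after k
  derivatives. It contributes (2k)!/k!, and the normalisation divides by 2^k k!.\<close>

lemma coeff_legendre_std:
  "Polynomial.coeff (legendre_std k) k = fact (2 * k) / (2 ^ k * (fact k)\<^sup>2)"
proof -
  have "Polynomial.coeff (legendre_std k) k = pochhammer (of_nat (Suc k)) k / (2 ^ k * fact k)"
    using coeff_x2m1_power[of k] by (simp add: legendre_std_def coeff_higher_pderiv mult_2)
  also have "pochhammer (real (Suc k)) k = fact (2 * k) / fact k"
    using pochhammer_product'[of "1 :: real" k k]
    unfolding mult_2[of k] by (simp add: pochhammer_fact[symmetric] nonzero_eq_divide_eq mult.commute)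
  finally show ?thesis
    by (simp add: power2_eq_square)
qed

text \<open>This integral remains in the squared norm of a Legendre polynomial after k integrations
  by parts. A one-step recursion in k evaluates it.\<close>

lemma poly_integral_x2m1_power:
  "poly_integral (- 1) 1 (x2m1 ^ k) = (- 1) ^ k * 2 * 4 ^ k * (fact k)\<^sup>2 / fact (2 * k + 1)"
proof (induction k)
  case 0
  then show ?case
    using poly_integral_pderiv[of "- 1" 1 "[:0, 1:]"] by (simp add: pderiv_pCons one_pCons)
next
  case (Suc k)
  \<comment> \<open>The polynomial x (x^2 - 1)^(k+1) vanishes at both ends. Writing x^2 as (x^2 - 1)
    + 1 in its derivative gives I(k+1) = -(2k+2)/(2k+3) I(k) for the integrals I(k) in
    question.\<close>
  have e: "pderiv (x2m1 ^ Suc k * [:0, 1:])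
      = Polynomial.smult (real (2 * k + 3)) (x2m1 ^ Suc k) + Polynomial.smult (real (2 * k + 2)) (x2m1 ^ k)"
  proof (rule poly_ext)
    fix x
    define u where "u = poly (x2m1 ^ k) x"
    have "poly (pderiv (x2m1 ^ Suc k * [:0, 1:])) x
        = (x * x - 1) * u + (1 + real k) * (2 * (x * x) * u)"
      unfolding pderiv_mult pderiv_power_Suc
      unfolding power_Suc poly_add poly_mult poly_smult u_def[symmetric]
      by (simp add: pderiv_pCons algebra_simps)
    also have "\<dots> = (2 * real k + 3) * ((x * x - 1) * u) + (2 * real k + 2) * u"
      by (simp add: algebra_simps)
    also have "\<dots> = poly (Polynomial.smult (real (2 * k + 3)) (x2m1 ^ Suc k)
        + Polynomial.smult (real (2 * k + 2)) (x2m1 ^ k)) x"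
      unfolding power_Suc poly_add poly_mult poly_smult u_def[symmetric]
      by (simp add: algebra_simps)
    finally show "poly (pderiv (x2m1 ^ Suc k * [:0, 1:])) x = \<dots>" .
  qed
  have solve: "x = - c / a" if "a * x + c = 0" "a \<noteq> 0" for a c x :: real
  proof -
    have "a * x = - c"
      using that by linarith
    then show ?thesis
      using that by (metis nonzero_mult_div_cancel_left)
  qed
  have ends: "poly (x2m1 ^ Suc k * [:0, 1:]) y = 0" if "y = 1 \<or> y = - 1" for y :: real
    using that unfolding power_Suc poly_mult by auto
  have "poly_integral (- 1) 1 (pderiv (x2m1 ^ Suc k * [:0, 1:])) = 0"
    by (simp only: poly_integral_pderiv ends) simp
  then have "real (2 * k + 3) * poly_integral (- 1) 1 (x2m1 ^ Suc k)
      + real (2 * k + 2) * poly_integral (- 1) 1 (x2m1 ^ k) = 0"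
    unfolding e by (simp only: poly_integral_add poly_integral_smult)
  then have "poly_integral (- 1) 1 (x2m1 ^ Suc k)
      = - (real (2 * k + 2) * poly_integral (- 1) 1 (x2m1 ^ k)) / real (2 * k + 3)"
    by (rule solve) simp
  also have "\<dots> = (- 1) ^ Suc k * 2 * 4 ^ Suc k * (fact (Suc k))\<^sup>2 / fact (2 * Suc k + 1)"
  proof -
    define X :: real where "X = (- 1) ^ k * 2 * 4 ^ k * (fact k)\<^sup>2 / fact (2 * k + 1)"
    have f1: "fact (2 * Suc k + 1) = (fact (2 * k + 1) :: real) * ((2 * real k + 3) * (2 * real k + 2))"
      by (simp add: algebra_simps)
    have f2: "fact (Suc k) = fact k * (real k + 1)"
      by (simp add: algebra_simps)
    have "(- 1) ^ Suc k * 2 * 4 ^ Suc k * (fact (Suc k))\<^sup>2 / fact (2 * Suc k + 1)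
        = X * (- 4 * (real k + 1)\<^sup>2 / ((2 * real k + 3) * (2 * real k + 2)))"
      unfolding X_def f1 f2 power_mult_distrib power_Suc times_divide_times_eq
      by (simp only: mult_ac mult_minus_left mult_minus_right mult_1_left)
    also have "- 4 * (real k + 1)\<^sup>2 / ((2 * real k + 3) * (2 * real k + 2))
        = - ((2 * real k + 2) / (2 * real k + 3))"
      by (simp add: divide_simps power2_eq_square) (simp add: algebra_simps)
    finally have fin: "(- 1) ^ Suc k * 2 * 4 ^ Suc k * (fact (Suc k))\<^sup>2 / fact (2 * Suc k + 1)
        = X * - ((2 * real k + 2) / (2 * real k + 3))" .
    show ?thesis
      unfolding Suc X_def[symmetric] fin
      by (simp only: of_nat_add of_nat_mult of_nat_numeral mult_minus_right minus_divide_left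
          times_divide_eq_right mult.commute)
  qed
  finally show ?case .
qed

text \<open>Rodrigues' formula presents \<open>legendre_std k\<close> as a k-fold derivative, so k
  integrations by parts move all derivatives to \<open>p\<close>. In particular, polynomials of
  degree below k integrate to zero against it.\<close>

lemma poly_integral_legendre_std_Rodrigues:
  "poly_integral (- 1) 1 (p * legendre_std k)
     = (- 1) ^ k / (2 ^ k * fact k) * poly_integral (- 1) 1 ((pderiv ^^ k) p * x2m1 ^ k)"
  using poly_integral_by_parts_iterated[of "- 1" 1 k "x2m1 ^ k" p] higher_pderiv_x2m1_power_ends
  by (simp add: legendre_std_def poly_integral_smult)

lemma poly_integral_legendre_std:
  "poly_integral (- 1) 1 (legendre_std j * legendre_std k)
     = (if j = k then 2 / (2 * real k + 1) else 0)"
proof -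
  have less: "poly_integral (- 1) 1 (legendre_std j * legendre_std k) = 0" if "j < k" for j k
    using that
    by (simp add: poly_integral_legendre_std_Rodrigues higher_pderiv_degree degree_legendre_std coeff_eq_0)
  have four: "(4 :: real) ^ k = 2 ^ k * 2 ^ k"
    by (simp flip: power_mult_distrib)
  have sign: "(- 1 :: real) ^ k * (- 1) ^ k = 1"
    by (simp flip: power_mult_distrib)
  \<comment> \<open>The k-th derivative of the k-th Legendre polynomial is the constant k! times its
    leading coefficient, so only the integral of \<open>x2m1 ^ k\<close> is left.\<close>
  have "poly_integral (- 1) 1 (legendre_std k * legendre_std k)
      = (- 1) ^ k / (2 ^ k * fact k) * (fact k * (fact (2 * k) / (2 ^ k * (fact k)\<^sup>2))
          * ((- 1) ^ k * 2 * 4 ^ k * (fact k)\<^sup>2 / fact (2 * k + 1)))"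
    by (simp add: poly_integral_legendre_std_Rodrigues higher_pderiv_degree degree_legendre_std
        poly_integral_smult poly_integral_x2m1_power coeff_legendre_std)
  also have "\<dots> = ((- 1) ^ k * (- 1) ^ k) * 2 * (fact (2 * k) / fact (2 * k + 1))"
    by (simp add: four power2_eq_square)
  also have "\<dots> = 2 / (2 * real k + 1)"
    unfolding sign by (simp add: add.commute)
  finally have "poly_integral (- 1) 1 (legendre_std k * legendre_std k) = 2 / (2 * real k + 1)" .
  then show ?thesis
    using less[of j k] less[of k j] by (cases j k rule: linorder_cases) (auto simp: mult.commute)
qed

section \<open>Legendre polynomials on an arbitrary interval\<close>

lemma degree_legendre_on:
  assumes "lo < hi"
  shows "Polynomial.degree (legendre_on lo hi k) = k"
  using assms by (simp add: legendre_on_def degree_pcompose degree_legendre_std)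

text \<open>For equal indices the two square roots multiply to (2k+1)/(hi-lo), which cancels the
  Jacobian (hi-lo)/2 and the squared norm 2/(2k+1) on [-1,1].\<close>

lemma poly_integral_legendre_on:
  assumes "lo < hi"
  shows "poly_integral lo hi (legendre_on lo hi j * legendre_on lo hi k) = (if j = k then 1 else 0)"
proof -
  let ?c = "\<lambda>k. sqrt ((2 * real k + 1) / (hi - lo))"
  have "poly_integral lo hi (legendre_on lo hi j * legendre_on lo hi k)
      = ?c j * ?c k * ((hi - lo) / 2 * poly_integral (- 1) 1 (legendre_std j * legendre_std k))"
    using poly_integral_pcompose[OF assms, of "legendre_std j * legendre_std k"]
    by (simp add: legendre_on_def pcompose_mult poly_integral_smult)
  also have "\<dots> = (if j = k then 1 else 0)"
  proof (cases "j = k")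
    case True
    have "?c k * ?c k = (2 * real k + 1) / (hi - lo)"
      using assms by simp
    then have "?c j * ?c k * ((hi - lo) / 2 * poly_integral (- 1) 1 (legendre_std j * legendre_std k))
        = (2 * real k + 1) / (hi - lo) * ((hi - lo) / 2 * (2 / (2 * real k + 1)))"
      by (simp only: True poly_integral_legendre_std simp_thms if_True)
    also have "\<dots> = 1"
    proof -
      have "x / y * (y / 2 * (2 / x)) = 1" if "x \<noteq> 0" "y \<noteq> 0" for x y :: real
        using that by simp
      then show ?thesis
        using assms by (smt (verit) of_nat_0_le_iff)
    qed
    finally show ?thesis
      by (simp only: True simp_thms if_True)
  qed (simp add: poly_integral_legendre_std)
  finally show ?thesis .
qed

lemma legendre_on_nonzero:
  assumes "lo < hi"
  shows "legendre_on lo hi k \<noteq> 0"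
  using poly_integral_legendre_on[OF assms, of k k] by auto


subsection \<open>Matrices of operators on univariate polynomials\<close>

text \<open>Acting on families of polynomials instead of coefficient vectors keeps the basis as a
  parameter, so the same calculus serves Legendre polynomials and monomials.\<close>

definition mat_comb :: "real mat \<Rightarrow> (nat \<Rightarrow> real poly) \<Rightarrow> nat \<Rightarrow> real poly" where
  "mat_comb M q \<beta> = (\<Sum>r<dim_row M. Polynomial.smult (M $$ (r, \<beta>)) (q r))"

abbreviation monomial :: "nat \<Rightarrow> real poly" where
  "monomial k \<equiv> Polynomial.monom 1 k"

lemma smult_sum_right: "Polynomial.smult c (sum f A) = (\<Sum>i\<in>A. Polynomial.smult c (f i))"
  by (induction A rule: infinite_finite_induct) (simp_all add: smult_add_right)

lemma mat_comb_cong: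
  "(\<And>r. r < dim_row M \<Longrightarrow> p r = q r) \<Longrightarrow> mat_comb M p = mat_comb M q"
  by (simp add: mat_comb_def fun_eq_iff)

text \<open>This is a right action: a column of \<open>A * B\<close> combines the columns of
  \<open>A\<close>, so \<open>A\<close> transforms the family first and \<open>B\<close> recombines
  the result.\<close>

lemma mat_comb_mult:
  assumes "dim_col A = dim_row B" "\<beta> < dim_col B"
  shows "mat_comb (A * B) q \<beta> = mat_comb B (mat_comb A q) \<beta>"
proof -
  have "mat_comb (A * B) q \<beta>
      = (\<Sum>r<dim_row A. \<Sum>k<dim_row B. Polynomial.smult (A $$ (r, k) * B $$ (k, \<beta>)) (q r))"
    using assms by (simp add: mat_comb_def scalar_prod_def smult_sum atLeast0LessThan)
  also have "\<dots> = (\<Sum>k<dim_row B. \<Sum>r<dim_row A. Polynomial.smult (A $$ (r, k) * B $$ (k, \<beta>)) (q r))"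
    by (rule sum.swap)
  also have "\<dots> = mat_comb B (mat_comb A q) \<beta>"
    by (simp add: mat_comb_def smult_sum_right mult.commute)
  finally show ?thesis .
qed

lemma mat_comb_add:
  assumes "dim_row A = dim_row B" "dim_col A = dim_col B" "\<beta> < dim_col B"
  shows "mat_comb (A + B) q \<beta> = mat_comb A q \<beta> + mat_comb B q \<beta>"
  using assms by (simp add: mat_comb_def smult_add_left sum.distrib)

lemma mat_comb_one: "\<beta> < k \<Longrightarrow> mat_comb (1\<^sub>m k) q \<beta> = q \<beta>"
proof -
  assume "\<beta> < k"
  have "mat_comb (1\<^sub>m k) q \<beta> = (\<Sum>r<k. if r = \<beta> then q r else 0)"
    unfolding mat_comb_def using \<open>\<beta> < k\<close> by (intro sum.cong) auto
  then show ?thesis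
    using \<open>\<beta> < k\<close> by simp
qed

lemma mat_comb_pderiv: "mat_comb M (\<lambda>r. pderiv (q r)) \<beta> = pderiv (mat_comb M q \<beta>)"
  using higher_pderiv_sum[of 1 "\<lambda>r. Polynomial.smult (M $$ (r, \<beta>)) (q r)" "{..<dim_row M}"]
  by (simp add: mat_comb_def pderiv_smult)

text \<open>Here \<open>c\<close> is itself a polynomial. With \<open>c\<close> equal to x and with
  \<open>mat_comb_pderiv\<close>, the operator p'' + x p' passes through a change of basis.\<close>

lemma mat_comb_linear:
  "mat_comb M (\<lambda>r. p r + c * q r) \<beta> = mat_comb M p \<beta> + c * mat_comb M q \<beta>"
  by (simp add: mat_comb_def smult_add_right sum.distrib sum_distrib_left)

lemma mat_comb_Md:
  assumes "\<beta> \<le> k"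
  shows "mat_comb (Md k) monomial \<beta> = pderiv (monomial \<beta>)"
proof -
  have "mat_comb (Md k) monomial \<beta>
      = (\<Sum>r<k + 1. if r + 1 = \<beta> then Polynomial.smult (real \<beta>) (monomial r) else 0)"
    unfolding mat_comb_def using assms by (intro sum.cong) (auto simp: Md_def)
  also have "\<dots> = pderiv (monomial \<beta>)"
    using assms by (cases \<beta>) (auto simp: pderiv_monom smult_monom)
  finally show ?thesis .
qed

lemma mat_comb_Mdd:
  assumes "\<beta> \<le> k"
  shows "mat_comb (Mdd k) monomial \<beta> = pderiv (pderiv (monomial \<beta>))"
proof -
  have "mat_comb (Mdd k) monomial \<beta>
      = (\<Sum>r<k + 1. if r + 2 = \<beta> then Polynomial.smult (real \<beta> * (real \<beta> - 1)) (monomial r) else 0)"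
    unfolding mat_comb_def using assms by (intro sum.cong) (auto simp: Mdd_def)
  also have "\<dots> = pderiv (pderiv (monomial \<beta>))"
  proof (cases "\<beta> < 2")
    case True
    then show ?thesis
      by (cases \<beta>) (auto simp: pderiv_monom)
  next
    case False
    then obtain m where "\<beta> = m + 2"
      by (metis add.commute le_Suc_ex not_less)
    then show ?thesis
      using assms by (simp add: pderiv_monom smult_monom)
  qed
  finally show ?thesis .
qed

lemma mat_comb_Mxd:
  assumes "\<beta> \<le> k"
  shows "mat_comb (Mxd k) monomial \<beta> = [:0, 1:] * pderiv (monomial \<beta>)"
proof -
  have "mat_comb (Mxd k) monomial \<beta>
      = (\<Sum>r<k + 1. if r = \<beta> then Polynomial.smult (real \<beta>) (monomial r) else 0)"
    unfolding mat_comb_def using assms by (intro sum.cong) (auto simp: Mxd_def)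
  also have "\<dots> = [:0, 1:] * pderiv (monomial \<beta>)"
    using assms by (cases \<beta>) (auto simp: pderiv_monom smult_monom simp flip: monom_Suc)
  finally show ?thesis .
qed

section \<open>Change of basis between monomials and Legendre polynomials\<close>

lemma mat_comb_Tmat:
  assumes "lo < hi" "\<beta> \<le> k"
  shows "mat_comb (Tmat lo hi k) monomial \<beta> = legendre_on lo hi \<beta>"
proof -
  have "mat_comb (Tmat lo hi k) monomial \<beta>
      = (\<Sum>r\<le>k. Polynomial.monom (Polynomial.coeff (legendre_on lo hi \<beta>) r) r)"
    unfolding mat_comb_def using assms
    by (intro sum.cong) (auto simp: Tmat_def smult_monom)
  also have "\<dots> = legendre_on lo hi \<beta>"
    using assms by (intro poly_as_sum_of_monoms') (simp add: degree_legendre_on)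
  finally show ?thesis .
qed

lemma Tmat_carrier: "Tmat lo hi k \<in> carrier_mat (k + 1) (k + 1)"
  by (simp add: Tmat_def)

text \<open>Since the \<alpha>-th Legendre polynomial has degree \<alpha>, the matrix is upper
  triangular with the nonzero leading coefficients on its diagonal. Hence \<open>mat_inverse\<close>
  returns \<open>Some\<close> and the \<open>the\<close> in \<open>Tinv\<close> yields a genuine
  inverse.\<close>

lemma Tinv:
  assumes "lo < hi"
  shows "Tinv lo hi k \<in> carrier_mat (k + 1) (k + 1)"
    and "Tmat lo hi k * Tinv lo hi k = 1\<^sub>m (k + 1)"
proof -
  let ?T = "Tmat lo hi k"
  have "upper_triangular ?T"
    by (rule upper_triangularI) (auto simp: Tmat_def degree_legendre_on[OF assms] intro!: coeff_eq_0)
  then have "Determinant.det ?T = prod_list (diag_mat ?T)"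
    by (rule det_upper_triangular[OF _ Tmat_carrier])
  also have "\<dots> \<noteq> 0"
  proof -
    have "Polynomial.coeff (legendre_on lo hi i) i \<noteq> 0" for i
      using legendre_on_nonzero[OF assms, of i] degree_legendre_on[OF assms, of i]
      by (metis leading_coeff_0_iff)
    then show ?thesis
      by (auto simp: prod_list_zero_iff diag_mat_def Tmat_def)
  qed
  finally have "?T \<in> Units (ring_mat TYPE(real) (k + 1) ())"
    by (rule det_non_zero_imp_unit[OF Tmat_carrier])
  then obtain B where B: "mat_inverse ?T = Some B"
    using mat_inverse(1)[OF Tmat_carrier[of lo hi k], where b = "()"]
    by (cases "mat_inverse ?T") auto
  from mat_inverse(2)[OF Tmat_carrier B] B
  show "Tinv lo hi k \<in> carrier_mat (k + 1) (k + 1)" "?T * Tinv lo hi k = 1\<^sub>m (k + 1)"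
    by (simp_all add: Tinv_def)
qed

lemma mat_comb_Tinv:
  assumes "lo < hi" "\<beta> \<le> k"
  shows "mat_comb (Tinv lo hi k) (legendre_on lo hi) \<beta> = monomial \<beta>"
proof -
  note c = Tmat_carrier[of lo hi k] Tinv(1)[OF assms(1), of k]
  have "mat_comb (Tinv lo hi k) (legendre_on lo hi) \<beta>
      = mat_comb (Tinv lo hi k) (mat_comb (Tmat lo hi k) monomial) \<beta>"
    using c by (intro fun_cong[OF mat_comb_cong]) (auto simp: mat_comb_Tmat[OF assms(1)])
  also have "\<dots> = mat_comb (Tmat lo hi k * Tinv lo hi k) monomial \<beta>"
    using c assms by (subst mat_comb_mult) auto
  finally show ?thesis
    using assms by (simp add: Tinv(2) mat_comb_one)
qed

text \<open>\<open>Tinv\<close> turns the Legendre family into the monomials, on which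
  \<open>M\<close> is known explicitly; \<open>Tmat\<close> then recombines the results as it
  recombines monomials into Legendre polynomials.\<close>

lemma mat_comb_conj_Tmat:
  assumes "lo < hi" "\<beta> \<le> k" "M \<in> carrier_mat (k + 1) (k + 1)"
  shows "mat_comb (Tinv lo hi k * M * Tmat lo hi k) (legendre_on lo hi) \<beta>
       = mat_comb (Tmat lo hi k) (mat_comb M monomial) \<beta>"
proof -
  note c = Tmat_carrier[of lo hi k] Tinv(1)[OF assms(1), of k] assms(3)
  have "mat_comb (Tinv lo hi k * M * Tmat lo hi k) (legendre_on lo hi) \<beta>
      = mat_comb (Tmat lo hi k) (mat_comb (Tinv lo hi k * M) (legendre_on lo hi)) \<beta>"
    using c assms(2) by (subst mat_comb_mult) auto
  also have "\<dots> = mat_comb (Tmat lo hi k) (mat_comb M (mat_comb (Tinv lo hi k) (legendre_on lo hi))) \<beta>"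
    using c by (intro fun_cong[OF mat_comb_cong] mat_comb_mult) auto
  also have "mat_comb M (mat_comb (Tinv lo hi k) (legendre_on lo hi)) = mat_comb M monomial"
    using c by (intro mat_comb_cong) (auto simp: mat_comb_Tinv[OF assms(1)])
  finally show ?thesis .
qed

lemma mat_comb_Dx:
  assumes "lo < hi" "\<beta> \<le> k"
  shows "mat_comb (Dx lo hi k) (legendre_on lo hi) \<beta> = pderiv (legendre_on lo hi \<beta>)"
proof -
  have "mat_comb (Dx lo hi k) (legendre_on lo hi) \<beta>
      = mat_comb (Tmat lo hi k) (mat_comb (Md k) monomial) \<beta>"
    unfolding Dx_def using assms by (intro mat_comb_conj_Tmat) (auto simp: Md_def)
  also have "\<dots> = mat_comb (Tmat lo hi k) (\<lambda>r. pderiv (monomial r)) \<beta>"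
    by (intro fun_cong[OF mat_comb_cong] mat_comb_Md) (simp add: Tmat_def)
  finally show ?thesis
    using assms by (simp add: mat_comb_pderiv mat_comb_Tmat)
qed

lemma mat_comb_Dlin:
  assumes "lo < hi" "\<beta> \<le> k"
  shows "mat_comb (Dlin lo hi k) (legendre_on lo hi) \<beta>
       = pderiv (pderiv (legendre_on lo hi \<beta>)) + [:0, 1:] * pderiv (legendre_on lo hi \<beta>)"
proof -
  have "mat_comb (Dlin lo hi k) (legendre_on lo hi) \<beta>
      = mat_comb (Tmat lo hi k) (mat_comb (Mdd k + Mxd k) monomial) \<beta>"
    unfolding Dlin_def using assms by (intro mat_comb_conj_Tmat) (auto simp: Mdd_def Mxd_def)
  also have "\<dots> = mat_comb (Tmat lo hi k)
      (\<lambda>r. pderiv (pderiv (monomial r)) + [:0, 1:] * pderiv (monomial r)) \<beta>"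
  proof (intro fun_cong[OF mat_comb_cong])
    fix r assume "r < dim_row (Tmat lo hi k)"
    then have r: "r \<le> k"
      by (simp add: Tmat_def)
    then show "mat_comb (Mdd k + Mxd k) monomial r
        = pderiv (pderiv (monomial r)) + [:0, 1:] * pderiv (monomial r)"
      by (subst mat_comb_add)
         (simp_all only: mat_comb_Mdd mat_comb_Mxd, simp_all add: Mdd_def Mxd_def)
  qed
  finally show ?thesis
    using assms by (simp only: mat_comb_linear mat_comb_pderiv mat_comb_Tmat)
qed


subsection \<open>Lagrange interpolation\<close>

text \<open>The weights are \<open>w \<alpha> k = \<integral> p\<^sub>\<alpha> l\<^sub>k\<close> with the Lagrange basis \<open>l\<^sub>k\<close>: the quadrature
  is exact because \<open>p\<^sub>\<beta>\<close> equals its own interpolant.\<close>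

lemma legendre_dual_evaluations:
  assumes "lo < hi"
  obtains pt :: "nat \<Rightarrow> real" and w :: "nat \<Rightarrow> nat \<Rightarrow> real"
  where "\<And>k. k \<le> n \<Longrightarrow> pt k \<in> {lo..hi}"
    and "\<And>\<alpha> \<beta>. \<beta> \<le> n \<Longrightarrow>
      (\<Sum>k\<le>n. w \<alpha> k * poly (legendre_on lo hi \<beta>) (pt k)) = (if \<alpha> = \<beta> then 1 else 0)"
proof -
  \<comment> \<open>Equispaced nodes; the denominator \<open>n + 1\<close> instead of
    \<open>n\<close> keeps \<open>pt\<close> injective also for \<open>n = 0\<close>.\<close>
  define pt :: "nat \<Rightarrow> real" where "pt k = lo + (hi - lo) * real k / real (n + 1)" for k
  define lag :: "nat \<Rightarrow> real poly" where
    "lag k = (\<Prod>j\<in>{..n} - {k}. Polynomial.smult (1 / (pt k - pt j)) [:- pt j, 1:])" for k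
  have pt_inj: "pt j = pt k \<longleftrightarrow> j = k" for j k
    using assms by (simp add: pt_def)
  have pt_mem: "pt k \<in> {lo..hi}" if "k \<le> n" for k
  proof -
    have "(hi - lo) * real k / real (n + 1) \<le> (hi - lo) * 1"
      unfolding times_divide_eq_right[symmetric]
      using assms that by (intro mult_left_mono) auto
    then show ?thesis
      using assms by (simp add: pt_def)
  qed
  have lag_eval: "poly (lag k) (pt i) = (if i = k then 1 else 0)" if "i \<le> n" "k \<le> n" for i k
  proof (cases "i = k")
    case True
    then show ?thesis
      unfolding lag_def poly_prod by (auto intro!: prod.neutral simp: pt_inj divide_simps)
  next
    case False
    then show ?thesis
      using that by (auto simp: lag_def poly_prod intro!: prod_zero bexI[of _ i])
  qed
  have lag_degree: "Polynomial.degree (lag k) \<le> n" if "k \<le> n" for k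
  proof -
    have "Polynomial.degree (lag k)
        \<le> (\<Sum>j\<in>{..n} - {k}. Polynomial.degree (Polynomial.smult (1 / (pt k - pt j)) [:- pt j, 1:]))"
      unfolding lag_def by (rule degree_prod_sum_le[unfolded comp_def]) simp
    also have "\<dots> \<le> (\<Sum>j\<in>{..n} - {k}. 1)"
      by (intro sum_mono) simp
    also have "\<dots> = n"
      using that by simp
    finally show ?thesis .
  qed
  have interp: "p = (\<Sum>k\<le>n. Polynomial.smult (poly p (pt k)) (lag k))"
    if "Polynomial.degree p \<le> n" for p
  proof (rule poly_eqI_degree[of "pt ` {..n}"])
    fix x assume "x \<in> pt ` {..n}"
    then obtain i where i: "i \<le> n" "x = pt i" by auto
    have "poly (\<Sum>k\<le>n. Polynomial.smult (poly p (pt k)) (lag k)) x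
        = (\<Sum>k\<le>n. if i = k then poly p (pt k) else 0)"
      unfolding poly_sum using i by (intro sum.cong) (auto simp: lag_eval)
    then show "poly p x = poly (\<Sum>k\<le>n. Polynomial.smult (poly p (pt k)) (lag k)) x"
      using i by simp
  next
    have card: "card (pt ` {..n}) = n + 1"
      using card_image[of pt "{..n}"] by (simp add: inj_on_def pt_inj)
    show "Polynomial.degree p < card (pt ` {..n})"
      using that card by simp
    have "Polynomial.degree (\<Sum>k\<le>n. Polynomial.smult (poly p (pt k)) (lag k)) \<le> n"
      by (intro degree_sum_le) (auto intro: order_trans[OF degree_smult_le] lag_degree)
    then show "Polynomial.degree (\<Sum>k\<le>n. Polynomial.smult (poly p (pt k)) (lag k)) < card (pt ` {..n})"
      using card by simp
  qed
  have poly_integral_sum: "poly_integral lo hi (sum f {..m}) = (\<Sum>k\<le>m. poly_integral lo hi (f k))"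
    for f and m :: nat
    using assms by (induction m) (simp_all add: poly_integral_add)
  show thesis
  proof
    fix \<alpha> \<beta> assume "\<beta> \<le> n"
    then have "legendre_on lo hi \<beta>
        = (\<Sum>k\<le>n. Polynomial.smult (poly (legendre_on lo hi \<beta>) (pt k)) (lag k))"
      using assms by (intro interp) (simp add: degree_legendre_on)
    then have "poly_integral lo hi (legendre_on lo hi \<alpha> * legendre_on lo hi \<beta>)
        = poly_integral lo hi (\<Sum>k\<le>n. Polynomial.smult (poly (legendre_on lo hi \<beta>) (pt k))
            (legendre_on lo hi \<alpha> * lag k))"
      by (metis (no_types, lifting) mult_smult_right sum.cong sum_distrib_left)
    then show "(\<Sum>k\<le>n. poly_integral lo hi (legendre_on lo hi \<alpha> * lag k) * poly (legendre_on lo hi \<beta>) (pt k))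
        = (if \<alpha> = \<beta> then 1 else 0)"
      using poly_integral_legendre_on[OF assms, of \<alpha> \<beta>]
      by (simp add: poly_integral_sum poly_integral_smult mult.commute)
  qed (use pt_mem in auto)
qed


subsection \<open>Product bases and tensors\<close>

lemma midx_eq_PiE: "midx n = PiE UNIV (\<lambda>i. {..n i})"
  by (auto simp: midx_def PiE_def)

lemma finite_midx [simp]: "finite (midx n)"
  unfolding midx_eq_PiE by (intro finite_PiE) auto

lemma prod_sum_midx:
  fixes f :: "'d::finite \<Rightarrow> nat \<Rightarrow> real"
  shows "(\<Prod>i\<in>UNIV. \<Sum>k\<le>n i. f i k) = (\<Sum>\<alpha>\<in>midx n. \<Prod>i\<in>UNIV. f i (\<alpha> i))"
  unfolding midx_eq_PiE by (rule prod_sum_PiE) auto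

text \<open>The univariate families \<open>q i\<close> are a parameter and may differ between
  coordinates. Legendre and monomial expansions are thus instances, and an operator acting in one
  coordinate becomes an update of \<open>q\<close> there.\<close>

definition poly_prod_sum ::
  "('d::finite \<Rightarrow> nat \<Rightarrow> real poly) \<Rightarrow> ('d \<Rightarrow> nat) \<Rightarrow> 'd tensor \<Rightarrow> real^'d \<Rightarrow> real" where
  "poly_prod_sum q n A x = (\<Sum>\<alpha>\<in>midx n. A \<alpha> * (\<Prod>i\<in>UNIV. poly (q i (\<alpha> i)) (x $ i)))"

abbreviation legendre_basis :: "real^'d::finite \<Rightarrow> real^'d \<Rightarrow> 'd \<Rightarrow> nat \<Rightarrow> real poly" where
  "legendre_basis a b i \<equiv> legendre_on (a $ i) (b $ i)"

lemma v_of_eq: "v_of a b n = poly_prod_sum (legendre_basis a b) n"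
  by (simp add: fun_eq_iff v_of_def poly_prod_sum_def leg_prod_def)

lemma tensor_op_midx:
  fixes M :: "'d::finite \<Rightarrow> real mat"
  assumes "\<And>i. M i \<in> carrier_mat (m i + 1) (n i + 1)"
  shows "tensor_op M A = trunc m (\<lambda>\<alpha>. \<Sum>\<beta>\<in>midx n. (\<Prod>j\<in>UNIV. M j $$ (\<alpha> j, \<beta> j)) * A \<beta>)"
proof -
  have "dim_row (M i) = m i + 1" "dim_col (M i) = n i + 1" for i
    using assms[of i] by auto
  then show ?thesis
    by (simp add: tensor_op_def trunc_def midx_def less_Suc_eq_le fun_eq_iff)
qed

text \<open>A tensor product of matrices is moved from the coefficients to the basis. After
  exchanging the two sums, the inner one factors over the coordinates into the univariate
  combinations \<open>mat_comb (M i) (q i)\<close>.\<close>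

lemma poly_prod_sum_tensor_op:
  fixes M :: "'d::finite \<Rightarrow> real mat"
  assumes M: "\<And>i. M i \<in> carrier_mat (m i + 1) (n i + 1)"
    and p: "\<And>i \<beta>. \<beta> \<le> n i \<Longrightarrow> mat_comb (M i) (q i) \<beta> = p i \<beta>"
  shows "poly_prod_sum q m (tensor_op M A) x = poly_prod_sum p n A x"
proof -
  have dims: "dim_row (M i) = m i + 1" for i
    using M[of i] by auto
  have p': "poly (p i \<beta>) y = (\<Sum>r\<le>m i. M i $$ (r, \<beta>) * poly (q i r) y)" if "\<beta> \<le> n i" for i \<beta> y
    by (simp add: p[OF that, symmetric] mat_comb_def poly_sum dims lessThan_Suc_atMost)
  have "poly_prod_sum q m (tensor_op M A) x
      = (\<Sum>\<alpha>\<in>midx m. \<Sum>\<beta>\<in>midx n. A \<beta> * (\<Prod>j\<in>UNIV. M j $$ (\<alpha> j, \<beta> j) * poly (q j (\<alpha> j)) (x $ j)))"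
    by (simp add: poly_prod_sum_def tensor_op_midx[OF M] trunc_def sum_distrib_right
        sum_distrib_left prod.distrib mult_ac)
  also have "\<dots> = (\<Sum>\<beta>\<in>midx n. \<Sum>\<alpha>\<in>midx m. A \<beta> * (\<Prod>j\<in>UNIV. M j $$ (\<alpha> j, \<beta> j) * poly (q j (\<alpha> j)) (x $ j)))"
    by (rule sum.swap)
  also have "\<dots> = (\<Sum>\<beta>\<in>midx n. A \<beta> * (\<Prod>j\<in>UNIV. \<Sum>r\<le>m j. M j $$ (r, \<beta> j) * poly (q j r) (x $ j)))"
    by (simp add: prod_sum_midx sum_distrib_left)
  also have "\<dots> = poly_prod_sum p n A x"
    unfolding poly_prod_sum_def by (intro sum.cong) (auto simp: p' midx_def)
  finally show ?thesis .
qed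

text \<open>Isolating factor \<open>i\<close> makes linearity in the family placed there
  visible.\<close>

lemma poly_prod_sum_upd:
  "poly_prod_sum (q(i := f)) n A x
     = (\<Sum>\<alpha>\<in>midx n. A \<alpha> * (poly (f (\<alpha> i)) (x $ i) * (\<Prod>j\<in>UNIV - {i}. poly (q j (\<alpha> j)) (x $ j))))"
  by (simp add: poly_prod_sum_def prod.remove[of UNIV i])

lemma poly_prod_sum_upd_add:
  "poly_prod_sum (q(i := \<lambda>k. f k + g k)) n A x
     = poly_prod_sum (q(i := f)) n A x + poly_prod_sum (q(i := g)) n A x"
  by (simp add: poly_prod_sum_upd sum.distrib[symmetric] algebra_simps)

lemma poly_prod_sum_upd_times_X:
  "poly_prod_sum (q(i := \<lambda>k. [:0, 1:] * f k)) n A x = x $ i * poly_prod_sum (q(i := f)) n A x"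
  by (simp add: poly_prod_sum_upd sum_distrib_left mult_ac)

lemma poly_prod_sum_sum:
  "poly_prod_sum q n (\<lambda>\<alpha>. \<Sum>i\<in>I. A i \<alpha>) x = (\<Sum>i\<in>I. poly_prod_sum q n (A i) x)"
  unfolding poly_prod_sum_def sum_distrib_right by (rule sum.swap)

lemma poly_prod_sum_at_pos:
  assumes "D \<in> carrier_mat (n i + 1) (n i + 1)"
    and "\<And>\<beta>. \<beta> \<le> n i \<Longrightarrow> mat_comb D (q i) \<beta> = f \<beta>"
  shows "poly_prod_sum q n (tensor_op (at_pos n i D) A) x = poly_prod_sum (q(i := f)) n A x"
  by (rule poly_prod_sum_tensor_op) (use assms in \<open>auto simp: at_pos_def mat_comb_one\<close>)

text \<open>Along direction \<open>i\<close> only the i-th factor varies. As the result is again a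
  \<open>poly_prod_sum\<close>, the lemma also applies to second derivatives.\<close>

lemma pd_poly_prod_sum:
  "pd i (poly_prod_sum q n A) = poly_prod_sum (q(i := \<lambda>k. pderiv (q i k))) n A"
proof
  fix x
  have "poly_prod_sum q n A (x + s *\<^sub>R axis i 1)
      = (\<Sum>\<alpha>\<in>midx n. A \<alpha> * (poly (q i (\<alpha> i)) (x $ i + s) * (\<Prod>j\<in>UNIV - {i}. poly (q j (\<alpha> j)) (x $ j))))" for s
    by (simp add: poly_prod_sum_def prod.remove[of UNIV i] axis_def)
  then have "((\<lambda>s. poly_prod_sum q n A (x + s *\<^sub>R axis i 1)) has_real_derivative
      poly_prod_sum (q(i := \<lambda>k. pderiv (q i k))) n A x) (at 0)"
    unfolding poly_prod_sum_upd
    by (auto intro!: derivative_eq_intros DERIV_chain2[OF poly_DERIV] simp: mult_ac)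
  then show "pd i (poly_prod_sum q n A) x = poly_prod_sum (q(i := \<lambda>k. pderiv (q i k))) n A x"
    unfolding pd_def by (rule DERIV_imp_deriv)
qed

text \<open>This is the Cauchy product in several variables: monomials multiply by adding
  exponents.\<close>

lemma tconv_eval:
  "poly_prod_sum (\<lambda>i. monomial) (dbl n) (tconv n A B) x
     = poly_prod_sum (\<lambda>i. monomial) n A x * poly_prod_sum (\<lambda>i. monomial) n B x"
proof -
  let ?m = "\<lambda>\<alpha>. \<Prod>i\<in>UNIV. x $ i ^ \<alpha> i"
  let ?g = "\<lambda>(\<alpha>, \<beta>) i. \<alpha> i + \<beta> i :: nat"
  let ?S = "midx n \<times> midx n"
  have "poly_prod_sum (\<lambda>i. monomial) (dbl n) (tconv n A B) x
      = (\<Sum>\<gamma>\<in>midx (dbl n). \<Sum>p | p \<in> ?S \<and> ?g p = \<gamma>. A (fst p) * B (snd p) * ?m (?g p))"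
    unfolding poly_prod_sum_def
  proof (rule sum.cong[OF refl])
    fix \<gamma>
    have "{(\<alpha>, \<beta>). \<alpha> \<in> midx n \<and> \<beta> \<in> midx n \<and> (\<forall>i. \<alpha> i + \<beta> i = \<gamma> i)} = {p. p \<in> ?S \<and> ?g p = \<gamma>}"
      by (auto simp: fun_eq_iff)
    then show "tconv n A B \<gamma> * (\<Prod>i\<in>UNIV. poly (monomial (\<gamma> i)) (x $ i))
        = (\<Sum>p | p \<in> ?S \<and> ?g p = \<gamma>. A (fst p) * B (snd p) * ?m (?g p))"
      by (auto simp: tconv_def poly_monom sum_distrib_right case_prod_beta intro!: sum.cong)
  qed
  \<comment> \<open>Pairs of multi-indices are grouped by their sum, which always lies in
    \<open>midx (dbl n)\<close>, so the fibres exhaust \<open>?S\<close>.\<close>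
  also have "\<dots> = (\<Sum>p\<in>?S. A (fst p) * B (snd p) * ?m (?g p))"
  proof (rule sum.group)
    show "?g ` ?S \<subseteq> midx (dbl n)"
      by (auto simp: midx_def dbl_def mult_2 intro: add_mono)
  qed auto
  also have "\<dots> = (\<Sum>\<alpha>\<in>midx n. \<Sum>\<beta>\<in>midx n. (A \<alpha> * ?m \<alpha>) * (B \<beta> * ?m \<beta>))"
    unfolding sum.cartesian_product
    by (intro sum.cong) (auto simp: power_add prod.distrib mult_ac)
  also have "\<dots> = poly_prod_sum (\<lambda>i. monomial) n A x * poly_prod_sum (\<lambda>i. monomial) n B x"
    by (simp add: poly_prod_sum_def poly_monom sum_product)
  finally show ?thesis .
qed


subsection \<open>The tensor operators represent the differential operators\<close>

lemma Dx_carrier: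
  "lo < hi \<Longrightarrow> Dx lo hi k \<in> carrier_mat (k + 1) (k + 1)"
  unfolding Dx_def
  by (intro mult_carrier_mat[of _ _ "k + 1"] Tinv(1) Tmat_carrier) (simp_all add: Md_def)

lemma Dlin_carrier:
  "lo < hi \<Longrightarrow> Dlin lo hi k \<in> carrier_mat (k + 1) (k + 1)"
  unfolding Dlin_def
  by (intro mult_carrier_mat[of _ _ "k + 1"] Tinv(1) Tmat_carrier) (simp_all add: Mdd_def Mxd_def)

context
  fixes a b :: "real^'d::finite" and n :: "'d \<Rightarrow> nat"
  assumes ab: "\<And>i. a $ i < b $ i"
begin

lemma v_of_Lx:
  "v_of a b n (Lx a b n i A) = pd i (v_of a b n A)"
proof
  fix x
  show "v_of a b n (Lx a b n i A) x = pd i (v_of a b n A) x"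
    unfolding v_of_eq Lx_def pd_poly_prod_sum
    by (intro poly_prod_sum_at_pos mat_comb_Dx Dx_carrier ab)
qed

text \<open>Summand \<open>i\<close> contributes the second partial derivative plus x_i times the
  first. Summing over \<open>i\<close> gives the Laplacian and the drift term.\<close>

lemma v_of_Lop:
  "v_of a b n (Lop a b n A) x = Lin (v_of a b n A) x"
proof -
  let ?q = "legendre_basis a b"
  have "v_of a b n (Lop a b n A) x
      = (\<Sum>i\<in>UNIV. poly_prod_sum ?q n (tensor_op (at_pos n i (Dlin (a $ i) (b $ i) (n i))) A) x)"
    by (simp add: v_of_eq Lop_def poly_prod_sum_sum)
  also have "\<dots> = (\<Sum>i\<in>UNIV. poly_prod_sum
      (?q(i := \<lambda>k. pderiv (pderiv (?q i k)) + [:0, 1:] * pderiv (?q i k))) n A x)"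
    by (intro sum.cong poly_prod_sum_at_pos Dlin_carrier mat_comb_Dlin ab refl)
  also have "\<dots> = Lin (v_of a b n A) x"
    by (simp only: poly_prod_sum_upd_add poly_prod_sum_upd_times_X)
       (simp add: Lin_def laplacian_def grad_def inner_vec_def v_of_eq pd_poly_prod_sum sum.distrib)
  finally show ?thesis .
qed

lemma v_of_to_mono:
  "v_of a b n A x = poly_prod_sum (\<lambda>i. monomial) n (to_mono a b n A) x"
  unfolding v_of_eq to_mono_def
  by (rule poly_prod_sum_tensor_op[symmetric]) (simp_all only: Tmat_carrier mat_comb_Tmat ab)

lemma v_of_from_mono:
  "v_of a b m (from_mono a b m A) x = poly_prod_sum (\<lambda>i. monomial) m A x"
  unfolding v_of_eq from_mono_def
  by (rule poly_prod_sum_tensor_op) (simp_all only: Tinv(1) mat_comb_Tinv ab)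

lemma v_of_Sq: "v_of a b (dbl n) (Sq a b n A) x = (v_of a b n A x)\<^sup>2"
  by (simp add: Sq_def Mult_def v_of_from_mono tconv_eval v_of_to_mono power2_eq_square)

lemma v_of_NL: "v_of a b (dbl n) (NL a b n A) x = NonLin (v_of a b n A) x"
proof -
  have "v_of a b (dbl n) (NL a b n A) x
      = - (\<Sum>i\<in>UNIV. v_of a b (dbl n) (Sq a b n (Lx a b n i A)) x)"
    by (simp add: NL_def v_of_eq flip: poly_prod_sum_sum) (simp add: poly_prod_sum_def sum_negf)
  then show ?thesis
    by (simp add: v_of_Sq v_of_Lx NonLin_def grad_def power2_norm_eq_inner inner_vec_def)
       (simp add: power2_eq_square)
qed

end


subsection \<open>Orthonormality and projection\<close>

text \<open>Fubini for products of univariate functions. Lebesgue measure on \<open>real^'d\<close>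
  is the image of a product measure indexed by \<open>Basis\<close>, and \<open>e\<close> reindexes
  this by the coordinates.\<close>

lemma lborel_integral_prod:
  fixes f :: "'d::finite \<Rightarrow> real \<Rightarrow> real"
  assumes "\<And>i. integrable lborel (f i)"
  shows "(\<integral>x. (\<Prod>i\<in>UNIV. f i ((x :: real^'d) $ i)) \<partial>lborel) = (\<Prod>i\<in>UNIV. \<integral>x. f i x \<partial>lborel)"
proof -
  interpret product_sigma_finite "\<lambda>_ :: real^'d. lborel :: real measure"
    by standard
  have [measurable]: "f i \<in> borel_measurable borel" for i
    using assms[of i] by auto
  define e :: "'d \<Rightarrow> real^'d" where "e i = axis i 1" for i
  have Basis: "(Basis :: (real^'d) set) = range e"
    by (auto simp: Basis_vec_def e_def)
  have inj: "inj e"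
    by (auto simp: inj_def e_def axis_eq_axis)
  have comp: "(\<Sum>b\<in>Basis. g b *\<^sub>R b) $ i = g (e i)" for g :: "real^'d \<Rightarrow> real" and i
    unfolding Basis using inj
    by (simp add: sum.reindex) (simp add: e_def axis_def if_distrib cong: if_cong)
  have "(\<integral>x. (\<Prod>i\<in>UNIV. f i ((x :: real^'d) $ i)) \<partial>lborel)
      = (\<integral>g. (\<Prod>i\<in>UNIV. f i ((\<Sum>b\<in>Basis. g b *\<^sub>R b) $ i)) \<partial>(\<Pi>\<^sub>M b\<in>(Basis :: (real^'d) set). lborel))"
    unfolding lborel_eq[where 'a = "real^'d"] by (rule integral_distr) measurable
  also have "\<dots> = (\<integral>g. (\<Prod>b\<in>Basis. f (inv_into UNIV e b) (g b)) \<partial>(\<Pi>\<^sub>M b\<in>(Basis :: (real^'d) set). lborel))"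
    unfolding comp unfolding Basis using inj by (simp add: prod.reindex)
  also have "\<dots> = (\<Prod>b\<in>(Basis :: (real^'d) set). \<integral>x. f (inv_into UNIV e b) x \<partial>lborel)"
    by (rule product_integral_prod) (use assms in auto)
  also have "\<dots> = (\<Prod>i\<in>UNIV. \<integral>x. f i x \<partial>lborel)"
    unfolding Basis using inj by (simp add: prod.reindex)
  finally show ?thesis .
qed

lemma continuous_on_leg_prod: "continuous_on S (leg_prod a b \<alpha>)"
  unfolding leg_prod_def
  by (intro continuous_on_prod continuous_on_poly continuous_on_component continuous_on_id)

lemma continuous_on_v_of: "continuous_on S (v_of a b n A)"
  unfolding v_of_def by (intro continuous_intros continuous_on_leg_prod)

context
  fixes a b :: "real^'d::finite"
  assumes ab: "\<And>i. a $ i < b $ i"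
begin

lemma L2_inner_leg_prod:
  "L2_inner a b (leg_prod a b \<alpha>) (leg_prod a b \<beta>) = (if \<alpha> = \<beta> then 1 else 0)"
proof -
  let ?p = "\<lambda>i. legendre_on (a $ i) (b $ i) (\<alpha> i) * legendre_on (a $ i) (b $ i) (\<beta> i)"
  let ?f = "\<lambda>i x. indicator {a $ i..b $ i} x *\<^sub>R poly (?p i) x"
  \<comment> \<open>The indicator of the box factors over the coordinates, which reduces
    orthonormality to one dimension.\<close>
  have "(indicator (cbox a b) x :: real) = (\<Prod>i\<in>UNIV. indicator {a $ i..b $ i} (x $ i))" for x
    by (auto simp: indicator_def mem_box_cart)
  then have "L2_inner a b (leg_prod a b \<alpha>) (leg_prod a b \<beta>)
      = (\<integral>x. (\<Prod>i\<in>UNIV. ?f i (x $ i)) \<partial>lborel)"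
    by (simp add: L2_inner_def set_lebesgue_integral_def leg_prod_def prod.distrib)
  also have "\<dots> = (\<Prod>i\<in>UNIV. \<integral>x. ?f i x \<partial>lborel)"
    by (intro lborel_integral_prod borel_integrable_compact) (auto intro!: continuous_intros)
  also have "\<dots> = (\<Prod>i\<in>UNIV. if \<alpha> i = \<beta> i then 1 else 0)"
    using poly_integral_legendre_on[OF ab]
    by (simp add: poly_integral_def set_lebesgue_integral_def)
  also have "\<dots> = (if \<alpha> = \<beta> then 1 else 0)"
    by (auto simp: fun_eq_iff)
  finally show ?thesis .
qed

lemma L2_inner_add:
  assumes "continuous_on (cbox a b) f" "continuous_on (cbox a b) g" "continuous_on (cbox a b) h"
  shows "L2_inner a b f (\<lambda>x. g x + h x) = L2_inner a b f g + L2_inner a b f h"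
  unfolding L2_inner_def distrib_left using assms
  by (intro set_integral_add)
     (unfold set_integrable_def, (intro borel_integrable_compact continuous_on_mult compact_cbox; simp)+)

text \<open>Orthonormality extracts one coefficient; \<open>trunc\<close> accounts for indices
  outside \<open>midx n\<close>, where the inner product is zero.\<close>

lemma L2_inner_v_of:
  "L2_inner a b (leg_prod a b \<alpha>) (v_of a b n A) = trunc n A \<alpha>"
proof -
  have int: "integrable lborel (\<lambda>x. indicator (cbox a b) x *\<^sub>R (leg_prod a b \<alpha> x * leg_prod a b \<beta> x))" for \<beta>
    by (intro borel_integrable_compact continuous_intros continuous_on_leg_prod compact_cbox)
  have "L2_inner a b (leg_prod a b \<alpha>) (v_of a b n A)
      = (\<integral>x. (\<Sum>\<beta>\<in>midx n. A \<beta> * (indicator (cbox a b) x *\<^sub>R (leg_prod a b \<alpha> x * leg_prod a b \<beta> x))) \<partial>lborel)"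
    by (simp add: L2_inner_def set_lebesgue_integral_def v_of_def sum_distrib_left mult_ac)
  also have "\<dots> = (\<Sum>\<beta>\<in>midx n. A \<beta> * L2_inner a b (leg_prod a b \<alpha>) (leg_prod a b \<beta>))"
    using int by (simp add: L2_inner_def set_lebesgue_integral_def)
  also have "\<dots> = trunc n A \<alpha>"
    by (simp add: L2_inner_leg_prod trunc_def if_distrib cong: if_cong)
  finally show ?thesis .
qed

lemma proj_HJB:
  assumes "\<And>i. n i \<le> m i"
  shows "proj a b n (\<lambda>y. v_of a b n A y + v_of a b m B y) = v_of a b n (\<lambda>\<alpha>. A \<alpha> + trunc n B \<alpha>)"
proof
  fix x
  \<comment> \<open>By this inclusion, the coefficients of \<open>B\<close> that the projection
    selects all occur in its expansion over \<open>midx m\<close>.\<close>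
  have "midx n \<subseteq> midx m"
    using assms by (auto simp: midx_def intro: order_trans)
  then show "proj a b n (\<lambda>y. v_of a b n A y + v_of a b m B y) x
      = v_of a b n (\<lambda>\<alpha>. A \<alpha> + trunc n B \<alpha>) x"
    unfolding proj_def
    by (subst v_of_def, intro sum.cong refl)
       (auto simp: L2_inner_add L2_inner_v_of continuous_on_leg_prod continuous_on_v_of trunc_def mult.commute)
qed


subsection \<open>Coefficients as combinations of point evaluations\<close>

text \<open>Nodes and weights are tensor products of the univariate ones. Their duality to the
  Legendre products recovers coefficients from values on the box, which yields uniqueness and
  carries time derivatives to the entries.\<close>

lemma v_of_dual_evaluations:
  obtains P :: "('d \<Rightarrow> nat) \<Rightarrow> real^'d" and W :: "('d \<Rightarrow> nat) \<Rightarrow> ('d \<Rightarrow> nat) \<Rightarrow> real"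
  where "\<And>\<kappa>. \<kappa> \<in> midx n \<Longrightarrow> P \<kappa> \<in> cbox a b"
    and "\<And>\<alpha> B. \<alpha> \<in> midx n \<Longrightarrow> B \<alpha> = (\<Sum>\<kappa>\<in>midx n. W \<alpha> \<kappa> * v_of a b n B (P \<kappa>))"
proof -
  have "\<exists>pt w. (\<forall>k\<le>n i. pt k \<in> {a $ i..b $ i}) \<and>
      (\<forall>\<alpha> \<beta>. \<beta> \<le> n i \<longrightarrow> (\<Sum>k\<le>n i. w \<alpha> k * poly (legendre_on (a $ i) (b $ i) \<beta>) (pt k))
          = (if \<alpha> = \<beta> then 1 else 0))" for i
    by (rule legendre_dual_evaluations[OF ab[of i], of "n i"]) blast
  then obtain pt :: "'d \<Rightarrow> nat \<Rightarrow> real" and w :: "'d \<Rightarrow> nat \<Rightarrow> nat \<Rightarrow> real"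
    where pt: "\<And>i k. k \<le> n i \<Longrightarrow> pt i k \<in> {a $ i..b $ i}"
      and w: "\<And>i \<alpha> \<beta>. \<beta> \<le> n i \<Longrightarrow>
        (\<Sum>k\<le>n i. w i \<alpha> k * poly (legendre_on (a $ i) (b $ i) \<beta>) (pt i k)) = (if \<alpha> = \<beta> then 1 else 0)"
    by metis
  define P :: "('d \<Rightarrow> nat) \<Rightarrow> real^'d" where "P \<kappa> = (\<chi> i. pt i (\<kappa> i))" for \<kappa>
  define W :: "('d \<Rightarrow> nat) \<Rightarrow> ('d \<Rightarrow> nat) \<Rightarrow> real" where "W \<alpha> \<kappa> = (\<Prod>i\<in>UNIV. w i (\<alpha> i) (\<kappa> i))" for \<alpha> \<kappa>
  have dual: "(\<Sum>\<kappa>\<in>midx n. W \<alpha> \<kappa> * leg_prod a b \<beta> (P \<kappa>)) = (if \<alpha> = \<beta> then 1 else 0)"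
    if "\<beta> \<in> midx n" for \<alpha> \<beta>
  proof -
    have "(\<Sum>\<kappa>\<in>midx n. W \<alpha> \<kappa> * leg_prod a b \<beta> (P \<kappa>))
        = (\<Prod>i\<in>UNIV. \<Sum>k\<le>n i. w i (\<alpha> i) k * poly (legendre_on (a $ i) (b $ i) (\<beta> i)) (pt i k))"
      by (simp add: prod_sum_midx W_def leg_prod_def P_def prod.distrib)
    also have "\<dots> = (\<Prod>i\<in>UNIV. if \<alpha> i = \<beta> i then 1 else 0)"
      using that by (intro prod.cong w refl) (auto simp: midx_def)
    also have "\<dots> = (if \<alpha> = \<beta> then 1 else 0)"
      by (auto simp: fun_eq_iff)
    finally show ?thesis .
  qed
  show thesis
  proof
    show "P \<kappa> \<in> cbox a b" if "\<kappa> \<in> midx n" for \<kappa>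
      using that pt by (auto simp: P_def mem_box_cart midx_def)
    fix \<alpha> B assume \<alpha>: "\<alpha> \<in> midx n"
    have "(\<Sum>\<kappa>\<in>midx n. W \<alpha> \<kappa> * v_of a b n B (P \<kappa>))
        = (\<Sum>\<beta>\<in>midx n. B \<beta> * (\<Sum>\<kappa>\<in>midx n. W \<alpha> \<kappa> * leg_prod a b \<beta> (P \<kappa>)))"
      unfolding v_of_def sum_distrib_left by (subst sum.swap) (simp add: mult_ac)
    also have "\<dots> = (\<Sum>\<beta>\<in>midx n. if \<alpha> = \<beta> then B \<beta> else 0)"
      by (intro sum.cong refl) (simp add: dual)
    finally show "B \<alpha> = (\<Sum>\<kappa>\<in>midx n. W \<alpha> \<kappa> * v_of a b n B (P \<kappa>))"
      using \<alpha> by simp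
  qed
qed

lemma tensor_eqI:
  assumes "A \<in> tensors n" "B \<in> tensors n"
    and "\<And>x. x \<in> cbox a b \<Longrightarrow> v_of a b n A x = v_of a b n B x"
  shows "A = B"
proof
  fix \<alpha>
  obtain P W where P: "\<And>\<kappa>. \<kappa> \<in> midx n \<Longrightarrow> P \<kappa> \<in> cbox a b"
    and W: "\<And>\<alpha> B. \<alpha> \<in> midx n \<Longrightarrow> B \<alpha> = (\<Sum>\<kappa>\<in>midx n. W \<alpha> \<kappa> * v_of a b n B (P \<kappa>))"
    by (rule v_of_dual_evaluations[of n]) blast
  show "A \<alpha> = B \<alpha>"
  proof (cases "\<alpha> \<in> midx n")
    case True
    then show ?thesis
      using W[OF True, of A] W[OF True, of B] P assms(3) by simp
  qed (use assms(1,2) in \<open>simp add: tensors_def\<close>)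
qed

text \<open>Both directions of the equivalence rest on this identification of the two right-hand
  sides.\<close>

lemma HJB_rhs:
  "proj a b n (\<lambda>y. Lin (v_of a b n A) y + NonLin (v_of a b n A) y)
     = v_of a b n (\<lambda>\<alpha>. Lop a b n A \<alpha> + trunc n (NL a b n A) \<alpha>)"
proof -
  have "n i \<le> dbl n i" for i
    by (simp add: dbl_def)
  from proj_HJB[of n "dbl n" "Lop a b n A" "NL a b n A", OF this] show ?thesis
    by (simp add: v_of_Lop v_of_NL ab)
qed

end

section \<open>The span of the Legendre products and coefficient tensors\<close>

lemma v_of_in_span_leg:
  fixes a b :: "real^'a::finite"
  shows "v_of a b n A \<in> span_leg a b n"
proof -
  have "(\<Sum>\<alpha>\<in>midx n. (\<lambda>x. A \<alpha> * leg_prod a b \<alpha> x)) \<in> span_leg a b n"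
    unfolding span_leg_def
    by (intro real_fun.span_sum real_fun.span_scale real_fun.span_base) auto
  also have "(\<Sum>\<alpha>\<in>midx n. (\<lambda>x. A \<alpha> * leg_prod a b \<alpha> x)) = v_of a b n A"
  proof -
    have "(\<Sum>\<alpha>\<in>S. f \<alpha>) x = (\<Sum>\<alpha>\<in>S. f \<alpha> x)"
      for S :: "('a \<Rightarrow> nat) set" and f :: "('a \<Rightarrow> nat) \<Rightarrow> real^'a \<Rightarrow> real" and x
      by (induction S rule: infinite_finite_induct) auto
    then show ?thesis
      by (simp add: v_of_def fun_eq_iff)
  qed
  finally show ?thesis .
qed

lemma span_leg_v_of:
  assumes "v \<in> span_leg a b n"
  obtains B where "B \<in> tensors n" "v = v_of a b n B"
proof -
  have "\<exists>B\<in>tensors n. v = v_of a b n B"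
    using assms unfolding span_leg_def
  proof (induction rule: real_fun.span_induct_alt)
    case base
    show ?case
      by (rule bexI[of _ "\<lambda>_. 0"]) (auto simp: v_of_def tensors_def fun_eq_iff)
  next
    case (step c f g)
    then obtain \<alpha> B where \<alpha>: "\<alpha> \<in> midx n" "f = leg_prod a b \<alpha>" and B: "B \<in> tensors n" "g = v_of a b n B"
      by auto
    \<comment> \<open>A scaled generator has the coefficient tensor with the single entry
      \<open>c\<close> at \<alpha>.\<close>
    have "(\<Sum>\<beta>\<in>midx n. (if \<beta> = \<alpha> then c else 0) * leg_prod a b \<beta> x) = c * leg_prod a b \<alpha> x" for x
      using \<alpha> by (simp add: if_distribR if_distrib[of "\<lambda>t. t * _"] cong: if_cong)
    then have "(\<lambda>x. c * f x) + g = v_of a b n (\<lambda>\<beta>. (if \<beta> = \<alpha> then c else 0) + B \<beta>)"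
      by (simp add: fun_eq_iff v_of_def \<alpha> B distrib_right sum.distrib)
    moreover have "(\<lambda>\<beta>. (if \<beta> = \<alpha> then c else 0) + B \<beta>) \<in> tensors n"
      using \<alpha> B by (auto simp: tensors_def)
    ultimately show ?case by blast
  qed
  with that show thesis by blast
qed

section \<open>Equivalence of the tensor equation and the projected equation\<close>

theorem theorem4p1:
  fixes a b :: "real^'d::finite" and n :: "'d \<Rightarrow> nat" and T :: real
    and \<Phi> :: "real^'d \<Rightarrow> real" and A0 :: "'d tensor"
  assumes "\<forall>i. a $ i < b $ i"
    and "T > 0"
    and "\<Phi> \<in> span_leg a b n"
    and "A0 \<in> tensors n"
    and "\<forall>x\<in>cbox a b. v_of a b n A0 x = \<Phi> x"
  shows "(\<forall>A. solves_ode a b n T A0 A \<longrightarrow> solves_hjb a b n T \<Phi> (\<lambda>t. v_of a b n (A t)))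
    \<and> (\<forall>v. solves_hjb a b n T \<Phi> v \<longrightarrow>
          (\<forall>t\<in>{0..T}. \<exists>!B. B \<in> tensors n \<and> (\<forall>x\<in>cbox a b. v t x = v_of a b n B x)) \<and>
          (\<forall>A. (\<forall>t\<in>{0..T}. A t \<in> tensors n \<and> (\<forall>x\<in>cbox a b. v t x = v_of a b n (A t) x))
               \<longrightarrow> solves_ode a b n T A0 A))"
proof (intro conjI allI impI)
  have ab: "a $ i < b $ i" for i
    using assms(1) by simp
  {
    fix A assume ode: "solves_ode a b n T A0 A"
    show "solves_hjb a b n T \<Phi> (\<lambda>t. v_of a b n (A t))"
      unfolding solves_hjb_def HJB_rhs[OF ab]
    proof (intro conjI ballI)
      show "v_of a b n (A 0) x = \<Phi> x" if "x \<in> cbox a b" for x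
        using ode assms(5) that by (simp add: solves_ode_def)
      fix t x assume "t \<in> {0..T}"
      with ode have "((\<lambda>s. A s \<alpha>) has_real_derivative
          Lop a b n (A t) \<alpha> + trunc n (NL a b n (A t)) \<alpha>) (at t within {0..T})" if "\<alpha> \<in> midx n" for \<alpha>
        using that by (simp add: solves_ode_def)
      \<comment> \<open>At fixed \<open>x\<close> the value is a finite linear combination of the
        entries, so their derivatives combine accordingly.\<close>
      then show "((\<lambda>s. v_of a b n (A s) x) has_real_derivative
          v_of a b n (\<lambda>\<alpha>. Lop a b n (A t) \<alpha> + trunc n (NL a b n (A t)) \<alpha>) x) (at t within {0..T})"
        unfolding v_of_def by (intro DERIV_sum DERIV_cmult_right) auto
    qed (rule v_of_in_span_leg)
  }
  fix v assume hjb: "solves_hjb a b n T \<Phi> v"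
  show "\<forall>t\<in>{0..T}. \<exists>!B. B \<in> tensors n \<and> (\<forall>x\<in>cbox a b. v t x = v_of a b n B x)"
  proof
    fix t assume "t \<in> {0..T}"
    with hjb have "v t \<in> span_leg a b n"
      by (simp add: solves_hjb_def)
    then obtain B where B: "B \<in> tensors n" "v t = v_of a b n B"
      by (rule span_leg_v_of)
    show "\<exists>!B. B \<in> tensors n \<and> (\<forall>x\<in>cbox a b. v t x = v_of a b n B x)"
      by (rule ex1I[of _ B]) (use B in \<open>auto intro!: tensor_eqI[OF ab]\<close>)
  qed
  fix A assume A: "\<forall>t\<in>{0..T}. A t \<in> tensors n \<and> (\<forall>x\<in>cbox a b. v t x = v_of a b n (A t) x)"
  \<comment> \<open>Agreement on the box is upgraded to equality of functions on the whole space, so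
    that \<open>v t\<close> may be replaced inside \<open>Lin\<close> and \<open>NonLin\<close>,
    whose derivatives look beyond the box at boundary points.\<close>
  have v_eq: "v t = v_of a b n (A t)" if "t \<in> {0..T}" for t
  proof -
    from hjb that have "v t \<in> span_leg a b n"
      by (simp add: solves_hjb_def)
    then obtain B where B: "B \<in> tensors n" "v t = v_of a b n B"
      by (rule span_leg_v_of)
    moreover have "A t = B"
      using A B that by (intro tensor_eqI[OF ab]) force+
    ultimately show ?thesis by simp
  qed
  obtain P W where P: "\<And>\<kappa>. \<kappa> \<in> midx n \<Longrightarrow> P \<kappa> \<in> cbox a b"
    and W: "\<And>\<alpha> B. \<alpha> \<in> midx n \<Longrightarrow> B \<alpha> = (\<Sum>\<kappa>\<in>midx n. W \<alpha> \<kappa> * v_of a b n B (P \<kappa>))"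
    by (rule v_of_dual_evaluations[OF ab, of n]) blast
  show "solves_ode a b n T A0 A"
    unfolding solves_ode_def
  proof (intro conjI ballI)
    show "A t \<in> tensors n" if "t \<in> {0..T}" for t
      using A that by simp
    have "v_of a b n (A 0) x = v_of a b n A0 x" if "x \<in> cbox a b" for x
      using hjb assms(2,5) v_eq[of 0] that by (simp add: solves_hjb_def)
    then show "A 0 = A0"
      using A assms(2,4) by (intro tensor_eqI[OF ab]) auto
    fix t \<alpha> assume t: "t \<in> {0..T}" and \<alpha>: "\<alpha> \<in> midx n"
    let ?R = "\<lambda>\<alpha>. Lop a b n (A t) \<alpha> + trunc n (NL a b n (A t)) \<alpha>"
    have "((\<lambda>s. v s (P \<kappa>)) has_real_derivative v_of a b n ?R (P \<kappa>)) (at t within {0..T})"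
      if "\<kappa> \<in> midx n" for \<kappa>
    proof -
      have "((\<lambda>s. v s (P \<kappa>)) has_real_derivative
          proj a b n (\<lambda>y. Lin (v t) y + NonLin (v t) y) (P \<kappa>)) (at t within {0..T})"
        using hjb t P[OF that] unfolding solves_hjb_def by blast
      then show ?thesis
        by (simp only: v_eq[OF t] HJB_rhs[OF ab])
    qed
    \<comment> \<open>The evaluation formula is applied to the tensor \<open>?R\<close> itself: the
      same weights that recover the entry of \<open>A s\<close> recover the entry of the right-hand
      side.\<close>
    then have "((\<lambda>s. \<Sum>\<kappa>\<in>midx n. W \<alpha> \<kappa> * v s (P \<kappa>)) has_real_derivative ?R \<alpha>) (at t within {0..T})"
      unfolding W[OF \<alpha>, of ?R] by (intro DERIV_sum DERIV_cmult) auto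
    moreover have "(\<Sum>\<kappa>\<in>midx n. W \<alpha> \<kappa> * v s (P \<kappa>)) = A s \<alpha>" if "s \<in> {0..T}" for s
      using v_eq[OF that] W[OF \<alpha>, of "A s"] by simp
    \<comment> \<open>The two functions of \<open>s\<close> agree only on \<open>{0..T}\<close>,
      which suffices for a derivative within that set; the radius 1 is arbitrary.\<close>
    ultimately show "((\<lambda>s. A s \<alpha>) has_real_derivative ?R \<alpha>) (at t within {0..T})"
      using t by (elim has_field_derivative_transform_within[where d = 1]) simp_all
  qed
qed

end
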